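(* Let $D\in\{1,2,3,7,11,19,43,67,163\}$ and let $$T_D=\begin{cases}\mathbb{Z}^+\setminus 4\mathbb{Z}^+ & \text{if } D=1,\\ \mathbb{Z}^+\setminus 6\mathbb{Z}^+ & \text{if } D=3,\\ \mathbb{Z}^+\setminus 2\mathbb{Z}^+ & \text{otherwise.}\end{cases}$$ Then for every positive integer $r$ such that the shell $\Lambda_D^r$ is nonempty, $\Lambda_D^r$ is an ellipsoidal $T_D$-design with strength $T_D$.
   Context: Put $\omega_D=\sqrt{-D}$ if $D\equiv1,2\pmod 4$ and $\omega_D=\frac{1+\sqrt{-D}}{2}$ if $D\equiv 3\pmod 4$. The ring of integers $\mathcal{O}_D=\mathbb{Z}[\omega_D]$ of $\mathbb{Q}(\sqrt{-D})$ is identified with $\mathbb{Z}^2$ via $(x,y)\leftrightarrow x+\omega_D y$. The norm $r$ ellipse is $$C_D(r)=\begin{cases}\{(x,y)\in\mathbb{R}^2: x^2+Dy^2=r\} & D\equiv 1,2 \pmod 4,\\ \{(x,y)\in\mathbb{R}^2: x^2+xy+\tfrac{1+D}{4}y^2=r\} & D\equiv 3\pmod 4,\end{cases}$$ and the norm $r$ shell is $\Lambda_D^r=\mathcal{O}_D\cap C_D(r)$, i.e. the set of $(x,y)\in\mathbb{Z}^2$ lying on $C_D(r)$. For an integer $j\ge 1$, $H^{\mathbb{R}}_{D,j}[x,y]$ is the real vector space of polynomials spanned by $\mathrm{Re}\big((x+\omega_D y)^j\big)$ and $\mathrm{Im}\big((x+\omega_D y)^j\big)$ ($x,y$ treated as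 real variables). For $T\subset\mathbb{Z}^+$ (possibly infinite), a finite nonempty set $X\subset C_D(r)$ is an ellipsoidal $T$-design if $\sum_{(x,y)\in X}P(x,y)=0$ for all $P\in H^{\mathbb{R}}_{D,j}[x,y]$ and all $j\in T$. It has strength $T$ if $T$ is maximal among the subsets of $\mathbb{Z}^+$ for which $X$ is such a design (so the condition fails as soon as any $j\in\mathbb{Z}^+\setminus T$ is added to $T$). *)

theory Defs
  imports Complex_Main
begin

text \<open>
  Definitions case-split only on whether \<^term>\<open>D mod 4 = (3::nat)\<close>; the ``else'' branch is meant
  for $D \equiv 1, 2 \pmod 4$, the only other residues of a squarefree \<open>D\<close>.
\<close>

definition omega :: "nat \<Rightarrow> complex" where
  "omega D = (if D mod 4 = 3 then (1 + \<i> * of_real (sqrt (real D))) / 2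
              else \<i> * of_real (sqrt (real D)))"

definition norm_ellipse :: "nat \<Rightarrow> real \<Rightarrow> (real \<times> real) set" where
  "norm_ellipse D r =
     (if D mod 4 = 3
      then {(x, y). x\<^sup>2 + x * y + (1 + real D) / 4 * y\<^sup>2 = r}
      else {(x, y). x\<^sup>2 + real D * y\<^sup>2 = r})"

text \<open>The ring of integers is identified with \<open>\<int> \<times> \<int>\<close> via $(x, y) \mapsto x + \omega_D y$.\<close>

definition norm_shell :: "nat \<Rightarrow> real \<Rightarrow> (real \<times> real) set" where
  "norm_shell D r = (\<int> \<times> \<int>) \<inter> norm_ellipse D r"

text \<open>
  Real bivariate polynomials are represented by the functions they induce on \<open>\<real> \<times> \<real>\<close>
  (faithfully, since \<open>\<real>\<close> is infinite).  The set below is the real linear span of the two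
  functions \<open>Re ((x + \<omega>\<^sub>D y) ^ j)\<close> and \<open>Im ((x + \<omega>\<^sub>D y) ^ j)\<close>.
\<close>

definition harm :: "nat \<Rightarrow> nat \<Rightarrow> (real \<times> real \<Rightarrow> real) set" where
  "harm D j =
     {(\<lambda>(x, y). a * Re ((of_real x + omega D * of_real y) ^ j)
              + b * Im ((of_real x + omega D * of_real y) ^ j)) | a b :: real. True}"

definition pos_nats :: "nat set" where
  "pos_nats = {n. 0 < n}"

definition ellipsoidal_design ::
  "nat \<Rightarrow> real \<Rightarrow> nat set \<Rightarrow> (real \<times> real) set \<Rightarrow> bool" where
  "ellipsoidal_design D r T X \<longleftrightarrow>
     T \<subseteq> pos_nats \<and> finite X \<and> X \<noteq> {} \<and> X \<subseteq> norm_ellipse D r \<and>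
     (\<forall>j\<in>T. \<forall>P\<in>harm D j. (\<Sum>p\<in>X. P p) = 0)"

definition has_strength ::
  "nat \<Rightarrow> real \<Rightarrow> nat set \<Rightarrow> (real \<times> real) set \<Rightarrow> bool" where
  "has_strength D r T X \<longleftrightarrow>
     ellipsoidal_design D r T X \<and>
     (\<forall>T'. T \<subset> T' \<and> T' \<subseteq> pos_nats \<longrightarrow> \<not> ellipsoidal_design D r T' X)"

definition T_set :: "nat \<Rightarrow> nat set" where
  "T_set D =
     (if D = 1 then pos_nats - (\<lambda>n. 4 * n) ` pos_nats
      else if D = 3 then pos_nats - (\<lambda>n. 6 * n) ` pos_nats
      else pos_nats - (\<lambda>n. 2 * n) ` pos_nats)"

end

(*
  Write S_j(n) for the sum of z^j over all ring elements z of norm n. Multiplying a shell by a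
  unit u gives S_j = u^j S_j, so S_j vanishes unless u^j = 1 for all units.
  If u^j = 1 for all units, S_j(n) is shown to be nonzero by removing one prime p from n at a time.
  If p is not a norm, p divides every z in the shell; if p = N(pi) with pi associate to its
  conjugate, pi does; both cases only contribute a nonzero factor. If p = N(pi) splits and
  n = p^m k with k prime to p, the elements not divisible by pi are exactly conj(pi)^m times the
  shell of k, so S_j(n) = h S_j(k) with h congruent to conj(pi)^(jm) modulo pi, hence nonzero.
  The only consequence of class number one needed is that a prime dividing a norm N(z) either
  divides z or is itself a norm. This follows from a Gauss reduction carried out on elements.
*)

theory Submission
  imports Defs "HOL-Number_Theory.Cong"
begin

section \<open>Arithmetic of the ring \<open>\<int>[w]\<close>\<close>

text \<open>Here \<open>w\<close> is a root of \<open>X^2 - t X + q\<close>, so \<open>t\<close> is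
  its trace and \<open>q\<close> its norm. This covers both shapes of \<open>omega D\<close> at
  once: \<open>t = 0\<close>, \<open>q = D\<close>, or \<open>t = 1\<close>,
  \<open>q = (1 + D) / 4\<close>. The field discriminant enters as
  \<open>t\<^sup>2 - 4 * q\<close>.\<close>

locale imag_quad =
  fixes w :: complex and t q :: int
  assumes w_sq: "w\<^sup>2 = of_int t * w - of_int q"
    and cnj_w: "cnj w = of_int t - w"
    and Im_w: "Im w \<noteq> 0"
    and disc: "t\<^sup>2 < 4 * q"
begin

definition ints :: "complex set" where
  "ints = {of_int x + of_int y * w | x y. True}"

definition idvd :: "complex \<Rightarrow> complex \<Rightarrow> bool" where
  "idvd a b \<longleftrightarrow> (\<exists>c\<in>ints. b = a * c)"

definition shell :: "nat \<Rightarrow> complex set" where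
  "shell n = {z \<in> ints. z * cnj z = of_nat n}"

definition power_sum :: "nat \<Rightarrow> nat \<Rightarrow> complex" where
  "power_sum j n = (\<Sum>z\<in>shell n. z ^ j)"

lemma intsI: "of_int x + of_int y * w \<in> ints"
  by (auto simp: ints_def)

lemma of_int_ints [simp]: "of_int x \<in> ints"
  using intsI[of x 0] by simp

lemma of_nat_ints [simp]: "of_nat x \<in> ints"
  using of_int_ints[of "int x"] by simp

lemma one_ints [simp]: "1 \<in> ints"
  using of_int_ints[of 1] by simp

lemma w_ints [simp]: "w \<in> ints"
  using intsI[of 0 1] by simp

lemma add_ints [simp]:
  assumes "a \<in> ints" "b \<in> ints"
  shows "a + b \<in> ints"
proof -
  obtain x y x' y' where "a = of_int x + of_int y * w" "b = of_int x' + of_int y' * w"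
    using assms by (auto simp: ints_def)
  then have "a + b = of_int (x + x') + of_int (y + y') * w"
    by (simp add: algebra_simps)
  then show ?thesis by (simp only: intsI)
qed

lemma mult_ints [simp]:
  assumes "a \<in> ints" "b \<in> ints"
  shows "a * b \<in> ints"
proof -
  obtain x y x' y' where ab: "a = of_int x + of_int y * w" "b = of_int x' + of_int y' * w"
    using assms by (auto simp: ints_def)
  have "a * b = of_int (x * x') + of_int (x * y' + y * x') * w + of_int (y * y') * w\<^sup>2"
    by (simp add: ab algebra_simps power2_eq_square)
  also have "\<dots> = of_int (x * x' - y * y' * q) + of_int (x * y' + y * x' + y * y' * t) * w"
    by (simp add: w_sq algebra_simps)
  finally show ?thesis by (simp only: intsI)
qed

lemma minus_ints [simp]: "a \<in> ints \<Longrightarrow> - a \<in> ints"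
  using mult_ints[OF of_int_ints[of "-1"], of a] by simp

lemma diff_ints [simp]: "a \<in> ints \<Longrightarrow> b \<in> ints \<Longrightarrow> a - b \<in> ints"
  using add_ints[of a "- b"] by simp

lemma power_ints [simp]: "a \<in> ints \<Longrightarrow> a ^ n \<in> ints"
  by (induction n) auto

lemma cnj_ints [simp]:
  assumes "a \<in> ints"
  shows "cnj a \<in> ints"
proof -
  obtain x y where "a = of_int x + of_int y * w"
    using assms by (auto simp: ints_def)
  then have "cnj a = of_int x + of_int y * (of_int t - w)"
    by (simp add: cnj_w)
  then show ?thesis by simp
qed

lemma coords_unique:
  assumes "of_int x + of_int y * w = of_int x' + of_int y' * w"
  shows "x = x'" "y = y'"
proof -
  show "y = y'" using arg_cong[OF assms, of Im] Im_w by simp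
  then show "x = x'" using assms by simp
qed

lemma norm_form:
  "(of_int x + of_int y * w) * cnj (of_int x + of_int y * w) = of_int (x\<^sup>2 + t * x * y + q * y\<^sup>2)"
proof -
  have "(of_int x + of_int y * w) * cnj (of_int x + of_int y * w)
      = of_int x ^ 2 + of_int (x * y * t) + of_int (y ^ 2) * (of_int t * w - w\<^sup>2)"
    by (simp add: cnj_w) (simp add: algebra_simps power2_eq_square)
  also have "\<dots> = of_int (x\<^sup>2 + t * x * y + q * y\<^sup>2)"
    by (subst w_sq) (simp add: mult_ac)
  finally show ?thesis .
qed

lemma norm_int:
  assumes "a \<in> ints"
  obtains l :: int where "a * cnj a = of_int l"
  using assms norm_form unfolding ints_def by blast

lemma norm_nat:
  assumes "a \<in> ints"
  obtains l :: nat where "a * cnj a = of_nat l"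
proof -
  obtain l :: int where l: "a * cnj a = of_int l" using norm_int assms .
  have "complex_of_real ((cmod a)\<^sup>2) = complex_of_real (of_int l)"
    using l by (simp only: complex_norm_square of_real_of_int_eq)
  then have "(cmod a)\<^sup>2 = of_int l" using of_real_eq_iff by blast
  then have "0 \<le> l" by (metis of_int_0_le_iff zero_le_power2)
  then show ?thesis using that[of "nat l"] l by simp
qed

lemma idvd_add: "idvd a b \<Longrightarrow> idvd a c \<Longrightarrow> idvd a (b + c)"
  unfolding idvd_def by (metis add_ints distrib_left)

lemma idvd_diff: "idvd a b \<Longrightarrow> idvd a c \<Longrightarrow> idvd a (b - c)"
  unfolding idvd_def by (metis diff_ints right_diff_distrib)

lemma idvd_mult: "idvd a b \<Longrightarrow> c \<in> ints \<Longrightarrow> idvd a (b * c)"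
  unfolding idvd_def by (metis mult.assoc mult_ints)

lemma idvd_mult2: "idvd a b \<Longrightarrow> c \<in> ints \<Longrightarrow> idvd a (c * b)"
  using idvd_mult by (simp add: mult.commute)

lemma idvd_triv: "c \<in> ints \<Longrightarrow> idvd a (a * c)"
  by (auto simp: idvd_def)

lemma idvd_refl: "idvd a a"
  using idvd_triv[of 1 a] by simp

lemma idvd_trans: "idvd a b \<Longrightarrow> idvd b c \<Longrightarrow> idvd a c"
  unfolding idvd_def by (metis mult.assoc mult_ints)

lemma idvd_cnj: "idvd a b \<Longrightarrow> idvd (cnj a) (cnj b)"
  unfolding idvd_def by (metis cnj_ints complex_cnj_mult)

lemma of_int_dvd_imp_idvd: "a dvd b \<Longrightarrow> idvd (of_int a) (of_int b)"
proof -
  assume "a dvd b"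
  then obtain c where "b = a * c" by blast
  then show ?thesis using idvd_triv[of "of_int c" "of_int a"] by simp
qed

end

section \<open>Elements of prime norm are prime\<close>

locale prime_norm = imag_quad +
  fixes p :: nat and \<pi> :: complex
  assumes prime_p: "prime p"
    and pi_ints [simp]: "\<pi> \<in> ints"
    and norm_pi: "\<pi> * cnj \<pi> = of_nat p"
begin

lemma pi_nz [simp]: "\<pi> \<noteq> 0"
  using norm_pi prime_p by auto

lemma pi_dvd_p: "idvd \<pi> (of_nat p)"
  unfolding norm_pi[symmetric] by (simp add: idvd_triv)

text \<open>Taking norms in \<open>k = \<pi> * c\<close> gives \<open>k\<^sup>2 = p * N(c)\<close>;
  conversely \<open>\<pi>\<close> divides its own norm \<open>p\<close>.\<close>

lemma pi_dvd_int_iff: "idvd \<pi> (of_int k) \<longleftrightarrow> int p dvd k"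
proof
  assume "idvd \<pi> (of_int k)"
  then obtain c where c: "c \<in> ints" "of_int k = \<pi> * c" by (auto simp: idvd_def)
  obtain l :: int where l: "c * cnj c = of_int l" using norm_int c(1) .
  have "of_int (k\<^sup>2) = of_int k * cnj (of_int k)"
    by (simp add: power2_eq_square)
  also have "\<dots> = (\<pi> * cnj \<pi>) * (c * cnj c)"
    by (simp only: c(2) complex_cnj_mult mult_ac)
  also have "\<dots> = of_int (int p * l)" by (simp add: norm_pi l)
  finally have "k\<^sup>2 = int p * l" by (simp only: of_int_eq_iff)
  then show "int p dvd k"
    using prime_p by (metis dvd_triv_left prime_dvd_power prime_nat_int_transfer)
next
  assume "int p dvd k"
  then show "idvd \<pi> (of_int k)"
    using idvd_trans[OF pi_dvd_p] of_int_dvd_imp_idvd[of "int p" k] by simp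
qed

text \<open>The residue ring modulo \<open>\<pi>\<close> is the field with \<open>p\<close>
  elements. Write \<open>\<pi> = a + b * w\<close>. If \<open>p\<close> divided \<open>b\<close>, it
  would divide \<open>a\<close> too, and then \<open>p * p\<close> would divide the norm
  \<open>p\<close>. So \<open>b\<close> has an inverse \<open>e\<close> modulo \<open>p\<close>, and
  \<open>w\<close> is congruent to \<open>- e * a\<close> modulo \<open>\<pi>\<close>.\<close>

lemma cong_int:
  assumes "z \<in> ints"
  obtains k :: int where "idvd \<pi> (z - of_int k)"
proof -
  obtain a b where ab: "\<pi> = of_int a + of_int b * w"
    using pi_ints by (auto simp: ints_def)
  have "of_int (int p) = (of_int (a\<^sup>2 + t * a * b + q * b\<^sup>2) :: complex)"
    using norm_pi norm_form[of a b] ab by simp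
  then have pab: "int p = a\<^sup>2 + t * a * b + q * b\<^sup>2" by (simp only: of_int_eq_iff)
  have "\<not> int p dvd b"
  proof
    assume b: "int p dvd b"
    have "a\<^sup>2 = int p - b * (t * a + q * b)"
      using pab by (simp add: algebra_simps power2_eq_square)
    then have "int p dvd a\<^sup>2" using b by simp
    then have "int p dvd a" using prime_p by (meson prime_dvd_power prime_nat_int_transfer)
    with b have "int p * int p dvd a\<^sup>2 + t * (a * b) + q * b\<^sup>2"
      unfolding power2_eq_square by (intro dvd_add dvd_mult mult_dvd_mono)
    then have "int p * int p dvd int p" using pab by (simp add: mult.assoc)
    then have "p * p dvd p" by (simp only: of_nat_mult[symmetric] int_dvd_int_iff)
    then show False using prime_p prime_gt_1_nat[of p] by (auto dest: dvd_imp_le)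
  qed
  then have "coprime b (int p)"
    using prime_p by (metis coprime_commute prime_imp_coprime prime_nat_int_transfer)
  then obtain e where "[b * e = 1] (mod int p)" using cong_solve_coprime_int by blast
  then have "int p dvd b * e - 1" by (simp add: cong_iff_dvd_diff)
  then obtain f where "b * e - 1 = int p * f" by blast
  then have f: "b * e = 1 + int p * f" by simp
  obtain x y where xy: "z = of_int x + of_int y * w" using assms by (auto simp: ints_def)
  have "of_int e * \<pi> = of_int (e * a) + of_int (b * e) * w"
    by (simp add: ab algebra_simps)
  then have "w - of_int (- e * a) = of_int e * \<pi> - of_nat p * (of_int f * w)"
    by (simp add: f algebra_simps)
  then have "idvd \<pi> (w - of_int (- e * a))"
    using idvd_diff[OF idvd_mult2[OF idvd_refl] idvd_mult[OF pi_dvd_p]] by simp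
  moreover have "z - of_int (x - y * e * a) = of_int y * (w - of_int (- e * a))"
    by (simp add: xy algebra_simps)
  ultimately show ?thesis using that[of "x - y * e * a"] idvd_mult2 by simp
qed

text \<open>Integer representatives of \<open>a\<close> and \<open>b\<close> modulo
  \<open>\<pi>\<close> reduce the claim to Euclid's lemma for \<open>p\<close> in the
  integers.\<close>

lemma pi_prime:
  assumes "a \<in> ints" "b \<in> ints" "idvd \<pi> (a * b)"
  shows "idvd \<pi> a \<or> idvd \<pi> b"
proof -
  obtain k where k: "idvd \<pi> (a - of_int k)" using cong_int assms(1) .
  obtain l where l: "idvd \<pi> (b - of_int l)" using cong_int assms(2) .
  \<comment> \<open>The expression simplifies to \<open>k * l\<close>.\<close>
  have "idvd \<pi> (a * b - ((a - of_int k) * b + of_int k * (b - of_int l)))"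
    using idvd_diff[OF assms(3) idvd_add[OF idvd_mult[OF k assms(2)] idvd_mult2[OF l of_int_ints]]] .
  then have "idvd \<pi> (of_int (k * l))" by (simp add: algebra_simps)
  then have "int p dvd k \<or> int p dvd l"
    using prime_p by (simp add: pi_dvd_int_iff prime_dvd_mult_iff del: of_int_mult)
  then have "idvd \<pi> (of_int k) \<or> idvd \<pi> (of_int l)" by (simp add: pi_dvd_int_iff)
  then show ?thesis using idvd_add[OF k, of "of_int k"] idvd_add[OF l, of "of_int l"] by auto
qed

lemma pi_not_dvd_1: "\<not> idvd \<pi> 1"
  using pi_dvd_int_iff[of 1] prime_p by (auto dest: not_prime_unit)

lemma pi_dvd_power: "a \<in> ints \<Longrightarrow> idvd \<pi> (a ^ n) \<Longrightarrow> idvd \<pi> a"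
  proof (induction n)
  case (Suc n)
  then show ?case using pi_prime[of a "a ^ n"] by auto
qed (simp add: pi_not_dvd_1)

text \<open>\<open>\<pi>\<close> divides \<open>z * cnj z\<close>, hence one of the factors; if it
  is \<open>cnj z\<close>, conjugation moves the statement to \<open>z\<close>.\<close>

lemma pi_dvd_shell:
  assumes "z \<in> shell (p * n)"
  shows "idvd \<pi> z \<or> idvd (cnj \<pi>) z"
proof -
  have "idvd \<pi> (z * cnj z)"
    using assms idvd_mult[OF pi_dvd_p, of "of_nat n"] by (simp add: shell_def)
  then have "idvd \<pi> z \<or> idvd \<pi> (cnj z)"
    using assms by (intro pi_prime) (auto simp: shell_def)
  then show ?thesis using idvd_cnj[of \<pi> "cnj z"] by auto
qed

end

section \<open>Shells and their power sums\<close>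

context imag_quad
begin

text \<open>Completing the square in either variable bounds both coordinates, because
  \<open>4 * q - t\<^sup>2\<close> is positive.\<close>

lemma finite_shell: "finite (shell n)"
proof -
  let ?B = "4 * q * int n"
  have "shell n \<subseteq> (\<lambda>(x, y). of_int x + of_int y * w) ` ({- ?B .. ?B} \<times> {- ?B .. ?B})"
  proof
    fix z assume z: "z \<in> shell n"
    then obtain x y where xy: "z = of_int x + of_int y * w" by (auto simp: shell_def ints_def)
    have "of_int (int n) = (of_int (x\<^sup>2 + t * x * y + q * y\<^sup>2) :: complex)"
      using z norm_form[of x y] xy by (simp add: shell_def)
    then have n: "int n = x\<^sup>2 + t * x * y + q * y\<^sup>2" by (simp only: of_int_eq_iff)
    have y: "4 * int n = (2 * x + t * y)\<^sup>2 + (4 * q - t\<^sup>2) * y\<^sup>2"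
      by (simp add: n algebra_simps power2_eq_square)
    have "q > 0" using disc by (smt (verit) zero_le_power2)
    have x: "4 * q * int n = (2 * q * y + t * x)\<^sup>2 + (4 * q - t\<^sup>2) * x\<^sup>2"
      by (simp add: n algebra_simps power2_eq_square)
    have le: "\<bar>u\<bar> \<le> u\<^sup>2" for u :: int
      by (cases "u = 0") (use power_increasing[of 1 2 "\<bar>u\<bar>"] in auto)
    have "u\<^sup>2 \<le> (4 * q - t\<^sup>2) * u\<^sup>2" for u :: int
      using mult_right_mono[of 1 "4 * q - t\<^sup>2" "u\<^sup>2"] disc by simp
    then have "x\<^sup>2 \<le> ?B" "y\<^sup>2 \<le> 4 * int n"
      using x y by (smt (verit) zero_le_power2)+
    moreover have "4 * int n \<le> ?B" using \<open>q > 0\<close> mult_right_mono[of 1 q "int n"] by simp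
    ultimately have "\<bar>x\<bar> \<le> ?B" "\<bar>y\<bar> \<le> ?B" using le[of x] le[of y] by linarith+
    then show "z \<in> (\<lambda>(x, y). of_int x + of_int y * w) ` ({- ?B .. ?B} \<times> {- ?B .. ?B})"
      using xy by (intro image_eqI[of _ _ "(x, y)"]) auto
  qed
  then show ?thesis by (rule finite_subset) auto
qed

lemma in_shell_iff:
  "of_int x + of_int y * w \<in> shell n \<longleftrightarrow> x\<^sup>2 + t * x * y + q * y\<^sup>2 = int n"
proof -
  have "of_int x + of_int y * w \<in> shell n \<longleftrightarrow>
      (of_int (x\<^sup>2 + t * x * y + q * y\<^sup>2) :: complex) = of_int (int n)"
    unfolding shell_def mem_Collect_eq norm_form using intsI by simp
  then show ?thesis by (simp only: of_int_eq_iff)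
qed

lemma shell_mult: "a \<in> shell m \<Longrightarrow> b \<in> shell n \<Longrightarrow> a * b \<in> shell (m * n)"
  by (auto simp: shell_def) (metis mult.assoc mult.left_commute)

lemma shell_power: "a \<in> shell m \<Longrightarrow> a ^ k \<in> shell (m ^ k)"
  by (induction k) (auto intro: shell_mult, auto simp: shell_def)

lemma shell_nz: "a \<in> shell m \<Longrightarrow> 0 < m \<Longrightarrow> a \<noteq> 0"
  by (auto simp: shell_def)

text \<open>The norm is multiplicative, so dividing by \<open>a\<close> turns norm
  \<open>m * n\<close> into norm \<open>n\<close>. All removals of primes below rest on
  this.\<close>

lemma multiples_in_shell:
  assumes "a \<in> shell m" "0 < m"
  shows "{z \<in> shell (m * n). idvd a z} = (*) a ` shell n"
proof (intro equalityI subsetI)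
  fix z assume "z \<in> {z \<in> shell (m * n). idvd a z}"
  then obtain c where c: "c \<in> ints" "z = a * c" and z: "z * cnj z = of_nat (m * n)"
    by (auto simp: shell_def idvd_def)
  have "(a * cnj a) * (c * cnj c) = z * cnj z" by (simp add: c mult_ac)
  then have "of_nat m * (c * cnj c) = of_nat m * of_nat n"
    using assms by (simp add: z shell_def)
  then have "c \<in> shell n" using assms c by (simp add: shell_def)
  then show "z \<in> (*) a ` shell n" using c by blast
next
  fix z assume "z \<in> (*) a ` shell n"
  then obtain c where c: "c \<in> shell n" "z = a * c" by blast
  then have "c \<in> ints" by (simp add: shell_def)
  then show "z \<in> {z \<in> shell (m * n). idvd a z}"
    using c shell_mult[OF assms(1) c(1)] idvd_triv by simp
qed

lemma sum_multiples:
  assumes "a \<noteq> 0"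
  shows "(\<Sum>z\<in>(*) a ` shell n. z ^ j) = a ^ j * power_sum j n"
proof -
  have "inj_on ((*) a) (shell n)" using assms by (auto simp: inj_on_def)
  then show ?thesis
    by (simp add: sum.reindex power_sum_def power_mult_distrib sum_distrib_left)
qed

lemma power_sum_all_multiples:
  assumes "a \<in> shell m" "0 < m" "\<And>z. z \<in> shell (m * n) \<Longrightarrow> idvd a z"
  shows "shell (m * n) = (*) a ` shell n" "power_sum j (m * n) = a ^ j * power_sum j n"
proof -
  show *: "shell (m * n) = (*) a ` shell n"
    using multiples_in_shell[OF assms(1,2), of n] assms(3) by auto
  show "power_sum j (m * n) = a ^ j * power_sum j n"
    using sum_multiples[OF shell_nz[OF assms(1,2)]] by (simp add: power_sum_def *)
qed

text \<open>A unit divides everything, as \<open>z = u * (cnj u * z)\<close>. Multiplication by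
  \<open>u\<close> therefore maps the shell onto itself and multiplies the sum by
  \<open>u ^ j\<close>.\<close>

lemma power_sum_eq_0:
  assumes "u \<in> shell 1" "u ^ j \<noteq> 1"
  shows "power_sum j n = 0"
proof -
  have "idvd u z" if "z \<in> shell n" for z
  proof -
    have "z = u * (cnj u * z)" using assms by (simp add: shell_def flip: mult.assoc)
    moreover have "cnj u * z \<in> ints" using assms that by (simp add: shell_def)
    ultimately show ?thesis unfolding idvd_def by blast
  qed
  then have "power_sum j n = u ^ j * power_sum j n"
    using power_sum_all_multiples(2)[OF assms(1), of n] by simp
  then show ?thesis using assms(2) by (simp add: algebra_simps)
qed

end

section \<open>Removing the full power of a split prime\<close>

context prime_norm
begin

lemma pi_shell: "\<pi> \<in> shell p" "cnj \<pi> \<in> shell p"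
  using norm_pi by (auto simp: shell_def mult.commute)

lemma p_pos: "0 < p"
  using prime_p prime_gt_0_nat by blast

context
  fixes k :: nat
  assumes split: "\<not> idvd \<pi> (cnj \<pi>)"
    and p_k: "\<not> p dvd k"
begin

lemma pi_not_dvd_shell:
  assumes "c \<in> shell k"
  shows "\<not> idvd \<pi> c"
proof
  assume "idvd \<pi> c"
  then have "idvd \<pi> (of_int (int k))"
    using idvd_mult[of \<pi> c "cnj c"] assms by (simp add: shell_def)
  then show False using p_k by (simp only: pi_dvd_int_iff int_dvd_int_iff)
qed

text \<open>If \<open>\<pi>\<close> does not divide \<open>z\<close>, then \<open>cnj \<pi>\<close>
  does, and \<open>\<pi>\<close> does not divide the quotient either, so the argument repeats
  \<open>m\<close> times.\<close>

lemma cnj_power_dvd: "z \<in> shell (p ^ m * k) \<Longrightarrow> \<not> idvd \<pi> z \<Longrightarrow> idvd (cnj \<pi> ^ m) z"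
proof (induction m arbitrary: z)
  case 0
  then show ?case using idvd_triv[of z 1] by (simp add: shell_def)
next
  case (Suc m)
  then have z: "z \<in> shell (p * (p ^ m * k))" by (simp add: mult_ac)
  then have "z \<in> {z \<in> shell (p * (p ^ m * k)). idvd (cnj \<pi>) z}"
    using Suc.prems pi_dvd_shell by blast
  then obtain c where c: "c \<in> shell (p ^ m * k)" "z = cnj \<pi> * c"
    unfolding multiples_in_shell[OF pi_shell(2) p_pos] by blast
  then have "idvd (cnj \<pi> ^ m) c"
    using Suc idvd_mult2[of \<pi> c "cnj \<pi>"] by auto
  then show ?case
    unfolding idvd_def c(2) by (auto simp: mult_ac)
qed

text \<open>One inclusion is \<open>cnj_power_dvd\<close>. For the other, the prime
  \<open>\<pi>\<close> divides neither \<open>cnj \<pi>\<close> nor an element whose norm is prime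
  to \<open>p\<close>.\<close>

lemma shell_split:
  "{z \<in> shell (p ^ m * k). \<not> idvd \<pi> z} = (*) (cnj \<pi> ^ m) ` shell k"
proof -
  have "\<not> idvd \<pi> (cnj \<pi> ^ m * c)" if "c \<in> shell k" for c
    using pi_prime[of "cnj \<pi> ^ m" c] pi_dvd_power[of "cnj \<pi>" m] split pi_not_dvd_shell[OF that] that
    by (auto simp: shell_def)
  then have "{z \<in> shell (p ^ m * k). \<not> idvd \<pi> z} = {z \<in> shell (p ^ m * k). idvd (cnj \<pi> ^ m) z}"
    using cnj_power_dvd[of _ m] multiples_in_shell[OF shell_power[OF pi_shell(2)], of m k] p_pos by auto
  then show ?thesis
    using multiples_in_shell[OF shell_power[OF pi_shell(2)], of m k] p_pos by simp
qed

text \<open>The shell is partitioned by whether \<open>\<pi>\<close> divides the element; this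
  yields the recursion \<open>power_sum_Suc\<close>.\<close>

lemma shell_Suc:
  "shell (p ^ Suc m * k) = (*) \<pi> ` shell (p ^ m * k) \<union> (*) (cnj \<pi> ^ Suc m) ` shell k"
  "(*) \<pi> ` shell (p ^ m * k) \<inter> (*) (cnj \<pi> ^ Suc m) ` shell k = {}"
  using shell_split[of "Suc m"] multiples_in_shell[OF pi_shell(1) p_pos, of "p ^ m * k"]
  by (auto simp: mult.assoc)

lemma shell_nonempty_cofactor: "shell (p ^ m * k) \<noteq> {} \<Longrightarrow> shell k \<noteq> {}"
  by (induction m) (auto simp del: power_Suc simp: shell_Suc(1))

lemma power_sum_Suc:
  "power_sum j (p ^ Suc m * k) =
     \<pi> ^ j * power_sum j (p ^ m * k) + (cnj \<pi> ^ Suc m) ^ j * power_sum j k"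
  unfolding power_sum_def[of _ "p ^ Suc m * k"] shell_Suc(1)
  by (subst sum.union_disjoint)
     (use shell_Suc(2) in \<open>auto simp del: power_Suc simp: finite_shell sum_multiples\<close>)

text \<open>The invariant is that \<open>\<pi>\<close> does not divide \<open>h\<close>: it passes
  through the recursion, since the first summand vanishes modulo \<open>\<pi>\<close> for
  \<open>j > 0\<close> and the second is a power of \<open>cnj \<pi>\<close>. Mere
  \<open>h \<noteq> 0\<close> could be lost by cancellation.\<close>

lemma power_sum_prime_power:
  assumes "0 < j"
  shows "\<exists>h\<in>ints. \<not> idvd \<pi> h \<and> power_sum j (p ^ m * k) = h * power_sum j k"
proof (induction m)
  case 0
  then show ?case using pi_not_dvd_1 by (intro bexI[of _ 1]) auto
next
  case (Suc m)
  then obtain h where h: "h \<in> ints" "power_sum j (p ^ m * k) = h * power_sum j k" by blast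
  let ?h = "\<pi> ^ j * h + (cnj \<pi> ^ Suc m) ^ j"
  have "idvd \<pi> (\<pi> ^ j * h)"
    using assms h(1) by (cases j) (auto simp: mult.assoc intro: idvd_triv)
  moreover have "\<not> idvd \<pi> ((cnj \<pi> ^ Suc m) ^ j)"
    using pi_dvd_power[of "cnj \<pi>"] split by (auto simp flip: power_mult simp del: power_Suc)
  ultimately have "\<not> idvd \<pi> ?h"
    using idvd_diff[of \<pi> ?h "\<pi> ^ j * h"] by auto
  moreover have "power_sum j (p ^ Suc m * k) = ?h * power_sum j k"
    unfolding power_sum_Suc h(2) by (simp add: algebra_simps)
  moreover have "?h \<in> ints" using h(1) by simp
  ultimately show ?case by blast
qed

end

end

section \<open>Reduction of forms and nonvanishing of power sums\<close>

text \<open>The assumption says that the only reduced form of the discriminant is the principal one.\<close>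

locale imag_quad_class_one = imag_quad +
  assumes reduced: "\<And>a b. 0 < a \<Longrightarrow> 3 * a\<^sup>2 \<le> 4 * q - t\<^sup>2 \<Longrightarrow> a dvd b\<^sup>2 + t * b + q \<Longrightarrow> a = 1"
begin

text \<open>
  Gauss reduction: normalise \<open>b\<close> modulo \<open>a\<close>, then pass from \<open>a\<close> to the cofactor \<open>c\<close> of
  \<open>b\<^sup>2 + t b + q = a c\<close>; a generator for \<open>c\<close> yields one for \<open>a\<close> as the complementary divisor.
\<close>

lemma descent:
  fixes a :: nat
  assumes "0 < a" "int a dvd b\<^sup>2 + t * b + q"
  shows "\<exists>\<gamma>\<in>ints. \<gamma> * cnj \<gamma> = of_nat a \<and> idvd \<gamma> (of_int b + w)"
  using assms
proof (induction a arbitrary: b rule: less_induct)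
  case (less a)
  \<comment> \<open>Rounding to a nearest integer, chosen to give
    \<open>\<bar>2 * b' + t\<bar> \<le> a\<close>.\<close>
  define k where "k = (2 * b + t + int a) div (2 * int a)"
  define b' where "b' = b - k * int a"
  have "2 * b' + t = (2 * b + t + int a) mod (2 * int a) - int a"
    unfolding b'_def k_def minus_mult_div_eq_mod[symmetric] by (simp add: algebra_simps)
  then have "\<bar>2 * b' + t\<bar> \<le> int a"
    using less.prems(1) pos_mod_bound[of "2 * int a" "2 * b + t + int a"]
      pos_mod_sign[of "2 * int a" "2 * b + t + int a"] by linarith
  then have b'_le: "(2 * b' + t)\<^sup>2 \<le> (int a)\<^sup>2"
    by (metis abs_le_square_iff abs_of_nat)
  have "b'\<^sup>2 + t * b' + q = (b\<^sup>2 + t * b + q) - int a * (k * (b + b' + t))"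
    by (simp add: b'_def algebra_simps power2_eq_square)
  then have "int a dvd b'\<^sup>2 + t * b' + q"
    using less.prems(2) by (metis dvd_diff dvd_triv_left)
  then obtain c' where c': "b'\<^sup>2 + t * b' + q = int a * c'" by blast
  have 4: "4 * (int a * c') = (2 * b' + t)\<^sup>2 + (4 * q - t\<^sup>2)"
    unfolding c'[symmetric] by (simp add: algebra_simps power2_eq_square)
  then have "0 < int a * c'" using disc by (smt (verit) zero_le_power2)
  then have "0 < c'" using less.prems(1) by (simp add: zero_less_mult_iff)
  then obtain c where c: "c' = int c" "0 < c" by (metis of_nat_0_less_iff zero_less_imp_eq_int)
  have "\<exists>\<gamma>\<in>ints. \<gamma> * cnj \<gamma> = of_nat a \<and> idvd \<gamma> (of_int b' + w)"
  proof (cases "c < a")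
    case True
    \<comment> \<open>Since \<open>- b' - t + w\<close> is \<open>- cnj (b' + w)\<close>, it has the
      same norm \<open>a * c\<close>, and the roles of \<open>a\<close> and \<open>c\<close> can be
      exchanged.\<close>
    have "(- b' - t)\<^sup>2 + t * (- b' - t) + q = int c * int a"
      using c' c by (simp add: algebra_simps power2_eq_square)
    then have "int c dvd (- b' - t)\<^sup>2 + t * (- b' - t) + q" by simp
    from less.IH[OF True c(2) this] obtain \<gamma> where
      \<gamma>: "\<gamma> \<in> ints" "\<gamma> * cnj \<gamma> = of_nat c" "idvd \<gamma> (of_int (- b' - t) + w)" by blast
    then obtain \<delta> where \<delta>: "\<delta> \<in> ints" "of_int (- b' - t) + w = \<gamma> * \<delta>"
      by (auto simp: idvd_def)
    have "of_int b' + w = - cnj (of_int (- b' - t) + w)"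
      by (simp add: cnj_w)
    also have "\<dots> = - cnj \<delta> * cnj \<gamma>"
      unfolding \<delta>(2) by simp
    finally have b': "of_int b' + w = - cnj \<delta> * cnj \<gamma>" .
    have "(of_int b' + w) * cnj (of_int b' + w) = of_int (b'\<^sup>2 + t * b' + q)"
      using norm_form[of b' 1] by simp
    also have "\<dots> = of_int (int c * int a)"
      unfolding c' c(1) by (simp add: mult.commute)
    finally have "(of_int b' + w) * cnj (of_int b' + w) = of_int (int c * int a)" .
    then have "(\<gamma> * cnj \<gamma>) * (\<delta> * cnj \<delta>) = of_nat c * of_nat a"
      unfolding b' by (simp add: mult_ac)
    then have "\<delta> * cnj \<delta> = of_nat a" using \<gamma>(2) c(2) by simp
    then show ?thesis
      using \<delta>(1) \<gamma>(1) unfolding b'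
      by (intro bexI[of _ "- cnj \<delta>"] conjI idvd_triv) (simp_all add: mult.commute)
  next
    case False
    \<comment> \<open>The form is now reduced: \<open>4 * a\<^sup>2 \<le> 4 * a * c' \<le> a\<^sup>2
      + (4 * q - t\<^sup>2)\<close>, which is the bound in \<open>reduced\<close>.\<close>
    then have "int a * int a \<le> int a * c'" using c by (intro mult_left_mono) auto
    then have "3 * (int a)\<^sup>2 \<le> 4 * q - t\<^sup>2"
      using 4 b'_le by (simp add: power2_eq_square)
    then have "int a = 1" using reduced[of "int a" b] less.prems by simp
    then show ?thesis by (intro bexI[of _ 1]) (auto simp: idvd_def)
  qed
  then obtain \<gamma> where \<gamma>: "\<gamma> \<in> ints" "\<gamma> * cnj \<gamma> = of_nat a" "idvd \<gamma> (of_int b' + w)" by blast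
  \<comment> \<open>As \<open>\<gamma>\<close> divides its norm \<open>a\<close>, the shift of
    \<open>b\<close> by a multiple of \<open>a\<close> can be undone.\<close>
  have "idvd \<gamma> (of_nat a)" using \<gamma>(1) idvd_triv[of "cnj \<gamma>" \<gamma>] by (simp add: \<gamma>(2))
  then have "idvd \<gamma> (of_int b' + w + of_nat a * of_int k)"
    using idvd_add[OF \<gamma>(3) idvd_mult[OF _ of_int_ints]] by blast
  then have "idvd \<gamma> (of_int b + w)" by (simp add: b'_def algebra_simps)
  then show ?case using \<gamma> by blast
qed

text \<open>Let \<open>z = x + y * w\<close>. If \<open>p\<close> divides \<open>y\<close>, the norm
  equation makes it divide \<open>x\<close> as well. Otherwise \<open>y\<close> is invertible modulo
  \<open>p\<close>, and scaling \<open>z\<close> to \<open>b + w\<close> gives an input for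
  \<open>descent\<close>.\<close>

lemma inert_or_norm:
  assumes p: "prime p" and z: "z \<in> shell (p * n)"
  shows "idvd (of_nat p) z \<or> (\<exists>\<pi>\<in>ints. \<pi> * cnj \<pi> = of_nat p)"
proof -
  obtain x y where xy: "z = of_int x + of_int y * w" using z by (auto simp: shell_def ints_def)
  then have "x\<^sup>2 + t * x * y + q * y\<^sup>2 = int (p * n)" using z in_shell_iff by simp
  then have N: "int p dvd x\<^sup>2 + t * x * y + q * y\<^sup>2" by simp
  have pp: "prime (int p)" using p by simp
  show ?thesis
  proof (cases "int p dvd y")
    case True
    have "x\<^sup>2 = (x\<^sup>2 + t * x * y + q * y\<^sup>2) - y * (t * x + q * y)"
      by (simp add: algebra_simps power2_eq_square)
    moreover have "int p dvd (x\<^sup>2 + t * x * y + q * y\<^sup>2) - y * (t * x + q * y)"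
      using N True by (intro dvd_diff dvd_mult2)
    ultimately have "int p dvd x" using pp by (metis prime_dvd_power)
    then have "idvd (of_int (int p)) z"
      unfolding xy by (intro idvd_add idvd_mult of_int_dvd_imp_idvd) (use True \<open>int p dvd x\<close> in auto)
    then show ?thesis by simp
  next
    case False
    then have "coprime y (int p)" using pp by (metis coprime_commute prime_imp_coprime)
    then obtain e where "[y * e = 1] (mod int p)" using cong_solve_coprime_int by blast
    then have e: "int p dvd y * e - 1" by (simp add: cong_iff_dvd_diff)
    define b where "b = x * e"
    \<comment> \<open>The norm of \<open>z\<close> times \<open>e\<^sup>2\<close>, with
      \<open>y * e\<close> replaced by \<open>1\<close>; the correction is a multiple of
      \<open>y * e - 1\<close>.\<close>
    have "b\<^sup>2 + t * b + q =
        (x\<^sup>2 + t * x * y + q * y\<^sup>2) * e\<^sup>2 - (y * e - 1) * (t * b + q * (y * e + 1))"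
      by (simp add: b_def algebra_simps power2_eq_square)
    moreover have "int p dvd
        (x\<^sup>2 + t * x * y + q * y\<^sup>2) * e\<^sup>2 - (y * e - 1) * (t * b + q * (y * e + 1))"
      using dvd_diff[OF dvd_mult2[OF N] dvd_mult2[OF e]] .
    ultimately have "int p dvd b\<^sup>2 + t * b + q" by simp
    then show ?thesis using descent[of p b] prime_gt_0_nat[OF p] by blast
  qed
qed

text \<open>Strong induction on \<open>n\<close>. Nonemptiness of the shell is carried along, since
  each removal of a prime must lead to a smaller norm that still occurs.\<close>

theorem power_sum_nonzero:
  assumes "\<And>u. u \<in> shell 1 \<Longrightarrow> u ^ j = 1" "0 < j" "0 < n" "shell n \<noteq> {}"
  shows "power_sum j n \<noteq> 0"
  using assms(3,4)
proof (induction n rule: less_induct)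
  case (less n)
  show ?case
  proof (cases "n = 1")
    case True
    \<comment> \<open>Every unit contributes \<open>1\<close>.\<close>
    then have "power_sum j n = of_nat (card (shell 1))"
      using assms(1) by (simp add: power_sum_def)
    then show ?thesis using less.prems True finite_shell by simp
  next
    case False
    then obtain p where p: "prime p" "p dvd n" using prime_factor_nat by blast
    then obtain n' where n': "n = p * n'" by blast
    have n'_less: "n' < n" "0 < n'" using less.prems p prime_gt_1_nat[of p] by (auto simp: n')
    show ?thesis
    proof (cases "\<exists>\<pi>\<in>ints. \<pi> * cnj \<pi> = of_nat p")
      case True
      then obtain \<pi> where "\<pi> \<in> ints" "\<pi> * cnj \<pi> = of_nat p" by blast
      then interpret prime_norm w t q p \<pi> using p by unfold_locales
      show ?thesis
      proof (cases "idvd \<pi> (cnj \<pi>)")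
        case True
        \<comment> \<open>Either alternative of \<open>pi_dvd_shell\<close> now gives divisibility
          by \<open>\<pi>\<close>, so the whole shell is a multiple of a smaller one.\<close>
        have "idvd \<pi> z" if "z \<in> shell (p * n')" for z
          using pi_dvd_shell[OF that] idvd_trans[OF True] by blast
        then have *: "shell n = (*) \<pi> ` shell n'" "power_sum j n = \<pi> ^ j * power_sum j n'"
          unfolding n' using power_sum_all_multiples[OF pi_shell(1) p_pos] by blast+
        then show ?thesis using less.IH[OF n'_less] less.prems by simp
      next
        case False
        obtain m k where k: "n = p ^ m * k" "\<not> p dvd k"
          using less.prems p(1) by (metis gr_implies_not0 multiplicity_decompose' not_prime_unit)
        have "m \<noteq> 0" using k p(2) by (cases m) auto
        then have "k < n" "0 < k"
          using k less.prems prime_gt_1_nat[OF p(1)] one_less_power[of p m] by (auto simp: k)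
        moreover have "shell k \<noteq> {}"
          using shell_nonempty_cofactor[OF False k(2)] less.prems k by blast
        ultimately have "power_sum j k \<noteq> 0" using less.IH by blast
        moreover obtain h where "h \<in> ints" "\<not> idvd \<pi> h" "power_sum j n = h * power_sum j k"
          using power_sum_prime_power[OF False k(2) assms(2)] k(1) by blast
        \<comment> \<open>This excludes \<open>h = 0\<close>.\<close>
        moreover have "idvd \<pi> 0" using pi_dvd_int_iff[of 0] by simp
        ultimately show ?thesis by auto
      qed
    next
      case False
      then have inert: "idvd (of_nat p) z" if "z \<in> shell (p * m)" for z m
        using inert_or_norm p(1) that by blast
      \<comment> \<open>One element \<open>z = p * c\<close> shows that \<open>n\<close> is
        \<open>p * p\<close> times the norm \<open>l\<close> of \<open>c\<close>, and
        \<open>c\<close> itself witnesses that the shell of \<open>l\<close> is nonempty.\<close>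
      obtain z where z: "z \<in> shell n" using less.prems by blast
      then obtain c where c: "c \<in> ints" "z = of_nat p * c" using inert by (auto simp: n' idvd_def)
      obtain l where l: "c * cnj c = of_nat l" using norm_nat c(1) .
      have "of_nat (p * n') = z * cnj z" using z by (simp add: shell_def n')
      also have "\<dots> = of_nat p * of_nat p * (c * cnj c)" by (simp add: c(2))
      also have "\<dots> = of_nat (p * (p * l))" by (simp add: l)
      finally have "of_nat (p * n') = (of_nat (p * (p * l)) :: complex)" .
      then have "n' = p * l" using p(1) by (simp only: of_nat_eq_iff) auto
      then have n: "n = (p * p) * l" using n' by simp
      have pp: "of_nat p \<in> shell (p * p)" "0 < p * p" using p prime_gt_0_nat by (auto simp: shell_def)
      have "idvd (of_nat p) z" if "z \<in> shell (p * p * l)" for z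
        using inert that by (simp add: mult.assoc)
      then have *: "power_sum j n = of_nat p ^ j * power_sum j l"
        unfolding n using power_sum_all_multiples(2)[OF pp] by blast
      have "0 < l" "1 < p * p"
        using less.prems prime_gt_1_nat[OF p(1)] less_1_mult[of p p] by (auto simp: n)
      then have "l < n" by (simp add: n)
      moreover have "shell l \<noteq> {}" using c(1) l by (auto simp: shell_def)
      ultimately have "power_sum j l \<noteq> 0" using less.IH \<open>0 < l\<close> by blast
      then show ?thesis using p(1) by (auto simp: *)
    qed
  qed
qed

end

section \<open>From power sums to designs\<close>

lemma norm_shell_bij:
  assumes "imag_quad (omega D) t q"
    and "\<And>x y. (of_int x, of_int y) \<in> norm_ellipse D (real r) \<longleftrightarrow> x\<^sup>2 + t * x * y + q * y\<^sup>2 = int r"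
  shows "bij_betw (\<lambda>(x, y). of_real x + omega D * of_real y)
    (norm_shell D (real r)) (imag_quad.shell (omega D) r)"
proof -
  interpret imag_quad "omega D" t q by fact
  have mem: "(of_int x, of_int y) \<in> norm_shell D (real r) \<longleftrightarrow>
      of_int x + omega D * of_int y \<in> shell r" for x y
    using assms(2)[of x y] in_shell_iff[of x y r] by (simp add: norm_shell_def mult.commute)
  show ?thesis
  proof (rule bij_betwI')
    fix u v assume "u \<in> norm_shell D (real r)" "v \<in> norm_shell D (real r)"
    then obtain a b c d where "u = (of_int a, of_int b)" "v = (of_int c, of_int d)"
      by (auto simp: norm_shell_def elim!: Ints_cases)
    then show "(case u of (x, y) \<Rightarrow> of_real x + omega D * of_real y) =
        (case v of (x, y) \<Rightarrow> of_real x + omega D * of_real y) \<longleftrightarrow> u = v"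
      using coords_unique[of a b c d] by (auto simp: mult.commute)
  next
    fix u assume u: "u \<in> norm_shell D (real r)"
    then obtain a b where "u = (of_int a, of_int b)"
      by (auto simp: norm_shell_def elim!: Ints_cases)
    then show "(case u of (x, y) \<Rightarrow> of_real x + omega D * of_real y) \<in> shell r"
      using u mem by simp
  next
    fix z assume z: "z \<in> shell r"
    then obtain x y where "z = of_int x + omega D * of_int y"
      by (auto simp: shell_def ints_def mult.commute)
    then show "\<exists>u\<in>norm_shell D (real r). z = (case u of (x, y) \<Rightarrow> of_real x + omega D * of_real y)"
      using z mem by (intro bexI[of _ "(of_int x, of_int y)"]) auto
  qed
qed

text \<open>The real and imaginary parts of one complex power sum are the sums of the two spanning
  functions, so the condition in degree \<open>j\<close> is a single complex equation.\<close>

lemma harm_sums_zero_iff: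
  "(\<forall>P\<in>harm D j. (\<Sum>p\<in>X. P p) = 0) \<longleftrightarrow>
     (\<Sum>(x, y)\<in>X. (of_real x + omega D * of_real y) ^ j) = 0"
proof -
  define f where "f = (\<lambda>(x, y). (of_real x + omega D * of_real y) ^ j)"
  have harm: "harm D j = {\<lambda>p. a * Re (f p) + b * Im (f p) | a b. True}"
    unfolding harm_def f_def by (simp add: case_prod_unfold)
  have "(\<Sum>p\<in>X. a * Re (f p) + b * Im (f p)) = a * Re (sum f X) + b * Im (sum f X)" for a b
    by (simp add: sum.distrib sum_distrib_left)
  moreover have "(\<forall>P\<in>harm D j. (\<Sum>p\<in>X. P p) = 0) \<longleftrightarrow>
      (\<forall>a b. (\<Sum>p\<in>X. a * Re (f p) + b * Im (f p)) = 0)"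
    unfolding harm by blast
  ultimately have "(\<forall>P\<in>harm D j. (\<Sum>p\<in>X. P p) = 0) \<longleftrightarrow>
      (\<forall>a b. a * Re (sum f X) + b * Im (sum f X) = 0)"
    by simp
  also have "\<dots> \<longleftrightarrow> sum f X = 0"
    by (metis add.right_neutral add_0 complex_eq_iff mult_1 mult_zero_left mult_zero_right
        zero_complex.sel)
  finally show ?thesis unfolding f_def .
qed

text \<open>The two unit hypotheses say that \<open>k\<close> is the exponent of the unit group.
  Hence the power sum of degree \<open>j > 0\<close> vanishes exactly when \<open>k\<close> does not
  divide \<open>j\<close>, and any larger set of degrees contains a multiple of
  \<open>k\<close>.\<close>

lemma shell_design_strength:
  assumes "imag_quad_class_one (omega D) t q"
    and ell: "\<And>x y. (of_int x, of_int y) \<in> norm_ellipse D (real r) \<longleftrightarrow>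
      x\<^sup>2 + t * x * y + q * y\<^sup>2 = int r"
    and unit1: "\<And>u. u \<in> imag_quad.shell (omega D) 1 \<Longrightarrow> u ^ k = 1"
    and unit2: "\<And>j. \<not> k dvd j \<Longrightarrow> \<exists>u\<in>imag_quad.shell (omega D) 1. u ^ j \<noteq> 1"
    and r: "0 < r" "norm_shell D (real r) \<noteq> {}"
    and T: "T = pos_nats - (\<lambda>n. k * n) ` pos_nats"
  shows "ellipsoidal_design D (real r) T (norm_shell D (real r)) \<and>
         has_strength D (real r) T (norm_shell D (real r))"
proof -
  interpret imag_quad_class_one "omega D" t q by fact
  let ?X = "norm_shell D (real r)"
  have bij: "bij_betw (\<lambda>(x, y). of_real x + omega D * of_real y) ?X (shell r)"
    using norm_shell_bij[OF imag_quad_axioms ell] .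
  have fin: "finite ?X" using bij_betw_finite[OF bij] finite_shell by simp
  have "shell r \<noteq> {}" using bij r(2) by (auto simp: bij_betw_def)
  have "power_sum j r = (\<Sum>p\<in>?X. (case p of (x, y) \<Rightarrow> of_real x + omega D * of_real y) ^ j)" for j
    unfolding power_sum_def by (rule sum.reindex_bij_betw[OF bij, symmetric])
  then have sum_iff: "(\<forall>P\<in>harm D j. (\<Sum>p\<in>?X. P p) = 0) \<longleftrightarrow> power_sum j r = 0" for j
    by (simp add: harm_sums_zero_iff case_prod_unfold)
  have T_iff: "j \<in> T \<longleftrightarrow> 0 < j \<and> \<not> k dvd j" for j
    by (auto simp: T pos_nats_def image_iff intro!: exI elim!: dvdE) (metis dvd_def neq0_conv)+
  have zero: "power_sum j r = 0" if "j \<in> T" for j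
    using power_sum_eq_0 unit2 that T_iff by blast
  have nonzero: "power_sum j r \<noteq> 0" if "0 < j" "j \<notin> T" for j
  proof (rule power_sum_nonzero)
    fix u assume "u \<in> shell 1"
    moreover obtain l where "j = k * l" using \<open>0 < j\<close> \<open>j \<notin> T\<close> T_iff by blast
    ultimately show "u ^ j = 1" using unit1 by (simp add: power_mult)
  qed fact+
  have design: "ellipsoidal_design D (real r) T ?X"
    using fin r(2) zero unfolding ellipsoidal_design_def sum_iff
    by (auto simp: T norm_shell_def)
  have "\<not> ellipsoidal_design D (real r) T' ?X" if "T \<subset> T'" "T' \<subseteq> pos_nats" for T'
  proof -
    obtain j where "j \<in> T'" "j \<notin> T" "0 < j" using \<open>T \<subset> T'\<close> \<open>T' \<subseteq> pos_nats\<close> by (auto simp: pos_nats_def)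
    then show ?thesis using nonzero by (auto simp: ellipsoidal_design_def sum_iff)
  qed
  then show ?thesis using design by (simp add: has_strength_def)
qed

section \<open>Units and the nine values of \<open>D\<close>\<close>

context imag_quad
begin

text \<open>In \<open>(2 * x + t * y)\<^sup>2 + (4 * q - t\<^sup>2) * y\<^sup>2 = 4\<close> the
  coefficient of \<open>y\<^sup>2\<close> exceeds \<open>4\<close>, which forces
  \<open>y = 0\<close>.\<close>

lemma shell_1_trivial:
  assumes "4 < 4 * q - t\<^sup>2" "u \<in> shell 1"
  shows "u = 1 \<or> u = - 1"
proof -
  obtain x y where u: "u = of_int x + of_int y * w" using assms by (auto simp: shell_def ints_def)
  then have N: "x\<^sup>2 + t * x * y + q * y\<^sup>2 = 1" using assms in_shell_iff[of x y 1] by simp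
  have "4 * (x\<^sup>2 + t * x * y + q * y\<^sup>2) = (2 * x + t * y)\<^sup>2 + (4 * q - t\<^sup>2) * y\<^sup>2"
    by (simp add: algebra_simps power2_eq_square)
  then have 4: "(2 * x + t * y)\<^sup>2 + (4 * q - t\<^sup>2) * y\<^sup>2 = 4" using N by simp
  have "y = 0"
  proof (rule ccontr)
    assume "y \<noteq> 0"
    then have "1 \<le> y\<^sup>2" by (simp add: int_one_le_iff_zero_less)
    then have "4 * q - t\<^sup>2 \<le> (4 * q - t\<^sup>2) * y\<^sup>2" using assms(1) mult_left_mono[of 1 "y\<^sup>2"] by simp
    then show False using 4 assms(1) by (smt (verit) zero_le_power2)
  qed
  then show ?thesis using N u by (auto simp: power2_eq_1_iff)
qed

lemma minus_1_shell: "- 1 \<in> shell 1"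
  by (simp add: shell_def)

end

lemma omega_3: "D mod 4 = 3 \<Longrightarrow> 0 < D \<Longrightarrow> imag_quad (omega D) 1 (int ((1 + D) div 4))"
proof unfold_locales
  assume D: "D mod 4 = 3" "0 < D"
  then have o: "omega D = (1 + \<i> * of_real (sqrt (real D))) / 2" by (simp add: omega_def)
  obtain m where m: "D = 4 * m + 3" using D by (metis mult_div_mod_eq)
  define s where "s = complex_of_real (sqrt (real D))"
  have s: "s\<^sup>2 = 4 * of_nat m + 3"
    unfolding s_def of_real_power[symmetric] by (simp add: m)
  have "(1 + D) div 4 = m + 1" by (simp add: m)
  moreover have "((1 + \<i> * s) / 2)\<^sup>2 = (1 + \<i> * s) / 2 - (1 + s\<^sup>2) / 4"
    by (simp add: field_simps power2_eq_square)
  ultimately show "(omega D)\<^sup>2 = of_int 1 * omega D - of_int (int ((1 + D) div 4))"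
    unfolding o s_def[symmetric] by (simp add: s add_divide_distrib)
  show "cnj (omega D) = of_int 1 - omega D" by (simp add: o field_simps)
  show "Im (omega D) \<noteq> 0" using D by (simp add: o)
  show "1\<^sup>2 < 4 * int ((1 + D) div 4)" by (simp add: m)
qed

lemma omega_12: "D mod 4 \<noteq> 3 \<Longrightarrow> 0 < D \<Longrightarrow> imag_quad (omega D) 0 (int D)"
proof unfold_locales
  assume D: "D mod 4 \<noteq> 3" "0 < D"
  then have o: "omega D = \<i> * of_real (sqrt (real D))" by (simp add: omega_def)
  show "(omega D)\<^sup>2 = of_int 0 * omega D - of_int (int D)"
    by (simp add: o power_mult_distrib flip: of_real_power)
qed (auto simp: omega_def)

lemma ellipse_3:
  assumes "D mod 4 = 3"
  shows "(of_int x, of_int y) \<in> norm_ellipse D (real r) \<longleftrightarrow>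
    x\<^sup>2 + 1 * x * y + int ((1 + D) div 4) * y\<^sup>2 = int r"
proof -
  obtain m where m: "D = 4 * m + 3" using assms by (metis mult_div_mod_eq)
  have "(1 + real D) / 4 = real ((1 + D) div 4)" by (simp add: m)
  then have "(of_int x, of_int y) \<in> norm_ellipse D (real r) \<longleftrightarrow>
      real_of_int (x\<^sup>2 + 1 * x * y + int ((1 + D) div 4) * y\<^sup>2) = real_of_int (int r)"
    using assms by (simp add: norm_ellipse_def)
  then show ?thesis by (simp only: of_int_eq_iff)
qed

lemma ellipse_12:
  assumes "D mod 4 \<noteq> 3"
  shows "(of_int x, of_int y) \<in> norm_ellipse D (real r) \<longleftrightarrow>
    x\<^sup>2 + 0 * x * y + int D * y\<^sup>2 = int r"
proof -
  have "(of_int x, of_int y) \<in> norm_ellipse D (real r) \<longleftrightarrow>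
      real_of_int (x\<^sup>2 + 0 * x * y + int D * y\<^sup>2) = real_of_int (int r)"
    using assms by (simp add: norm_ellipse_def)
  then show ?thesis by (simp only: of_int_eq_iff)
qed

text \<open>The listed \<open>q\<close> are \<open>(1 + D) / 4\<close> for the seven
  \<open>D\<close> congruent to \<open>3\<close> modulo \<open>4\<close>. The bound
  \<open>3 * a\<^sup>2 \<le> 163\<close> leaves \<open>a \<le> 7\<close>, and divisibility depends
  only on \<open>b\<close> modulo \<open>a\<close>, so a finite check remains.\<close>

lemma reduced_class_one:
  fixes a b q :: int
  assumes "q \<in> {1, 2, 3, 5, 11, 17, 41}" "0 < a" "3 * a\<^sup>2 \<le> 4 * q - 1" "a dvd b\<^sup>2 + b + q"
  shows "a = 1"
proof -
  have "a \<le> 7"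
  proof (rule ccontr)
    assume "\<not> a \<le> 7"
    then have "8\<^sup>2 \<le> a\<^sup>2" by (intro power_mono) auto
    then show False using assms(1,3) by auto
  qed
  then have a: "a \<in> {1, 2, 3, 4, 5, 6, 7}" using assms(2) by auto
  define c where "c = b mod a"
  have "0 \<le> c" "c < a" using assms(2) by (simp_all add: c_def)
  then have c: "c \<in> {0, 1, 2, 3, 4, 5, 6}" using \<open>a \<le> 7\<close> by auto
  have "c\<^sup>2 + c + q = (b\<^sup>2 + b + q) - (b - c) * (b + c + 1)"
    by (simp add: algebra_simps power2_eq_square)
  moreover have "a dvd b - c" by (simp add: c_def)
  then have "a dvd (b\<^sup>2 + b + q) - (b - c) * (b + c + 1)"
    using dvd_diff[OF assms(4) dvd_mult2] by blast
  ultimately have "a dvd c\<^sup>2 + c + q" by (simp only:)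
  then have 0: "(c\<^sup>2 + c + q) mod a = 0" by simp
  show ?thesis
    using a c assms(1,3) 0 \<open>c < a\<close> by (elim insertE emptyE; simp)
qed

lemma units_gauss:
  assumes "imag_quad (omega 1) 0 1" "u \<in> imag_quad.shell (omega 1) 1"
  shows "u ^ 4 = 1"
proof -
  interpret imag_quad "omega 1" 0 1 by fact
  obtain x y where u: "u = of_int x + of_int y * omega 1"
    using assms(2) by (auto simp: shell_def ints_def simp del: One_nat_def)
  then have N: "x\<^sup>2 + y\<^sup>2 = 1" using assms(2) in_shell_iff[of x y 1] by (simp del: One_nat_def)
  have "x = 0 \<and> y\<^sup>2 = 1 \<or> y = 0 \<and> x\<^sup>2 = 1"
  proof (cases "x = 0")
    case False
    then have "1 \<le> x\<^sup>2" by (simp add: int_one_le_iff_zero_less)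
    then have "y\<^sup>2 = 0" using N by (smt (verit) zero_le_power2)
    then show ?thesis using N by simp
  qed (use N in auto)
  moreover have "(omega 1)\<^sup>2 = - 1" using w_sq by (simp del: One_nat_def)
  ultimately have "u\<^sup>2 = 1 \<or> u\<^sup>2 = - 1"
    unfolding u by (auto simp: power_mult_distrib simp flip: of_int_power simp del: One_nat_def)
  moreover have "u ^ 4 = (u\<^sup>2)\<^sup>2" by (simp flip: power_mult)
  ultimately show ?thesis by (elim disjE) (simp_all only: power_one power2_minus)
qed

lemma omega_3_square: "omega 3 * omega 3 = omega 3 - 1"
proof -
  have "(complex_of_real (sqrt 3))\<^sup>2 = 3" by (simp flip: of_real_power)
  then show ?thesis by (simp add: omega_def field_simps power2_eq_square)
qed

lemma omega_3_cube: "omega 3 ^ 3 = - 1"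
  by (simp add: power3_eq_cube mult.assoc omega_3_square left_diff_distrib right_diff_distrib)

lemma units_eisenstein:
  assumes "imag_quad (omega 3) 1 1" "u \<in> imag_quad.shell (omega 3) 1"
  shows "u ^ 6 = 1"
proof -
  interpret imag_quad "omega 3" 1 1 by fact
  obtain x y where u: "u = of_int x + of_int y * omega 3"
    using assms(2) by (auto simp: shell_def ints_def)
  then have N: "x\<^sup>2 + x * y + y\<^sup>2 = 1" using assms(2) in_shell_iff[of x y 1] by simp
  \<comment> \<open>Completing the square in each variable confines both coordinates to
    \<open>-1\<close>, \<open>0\<close>, \<open>1\<close>; the norm equation then leaves six
    units.\<close>
  have "4 = (2 * x + y)\<^sup>2 + 3 * y\<^sup>2" "4 = (2 * y + x)\<^sup>2 + 3 * x\<^sup>2"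
    using N by (simp_all add: algebra_simps power2_eq_square)
  then have "y\<^sup>2 \<le> 1" "x\<^sup>2 \<le> 1"
    by (smt (verit) zero_le_power2)+
  then have "\<bar>y\<bar> \<le> 1" "\<bar>x\<bar> \<le> 1"
    by (simp_all add: abs_square_le_1)
  then have "y \<in> {-1, 0, 1}" "x \<in> {-1, 0, 1}" by auto
  then have "u \<in> {1, - 1, omega 3, - omega 3, omega 3 - 1, 1 - omega 3}"
    using N u by auto
  moreover have "(omega 3 - 1) ^ 3 = 1"
    by (simp add: power3_eq_cube mult.assoc omega_3_square left_diff_distrib right_diff_distrib)
  moreover have "(1 - omega 3) ^ 3 = - ((omega 3 - 1) ^ 3)"
    by (simp add: power3_eq_cube algebra_simps)
  ultimately have "u ^ 3 = 1 \<or> u ^ 3 = - 1" using omega_3_cube by auto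
  moreover have "u ^ 6 = (u ^ 3)\<^sup>2" by (simp flip: power_mult)
  ultimately show ?thesis by (elim disjE) (simp_all only: power_one power2_minus)
qed

lemma i_power_neq_1: "\<not> 4 dvd j \<Longrightarrow> \<i> ^ j \<noteq> 1"
proof -
  assume j: "\<not> 4 dvd j"
  have "\<i> ^ j = (\<i> ^ 4) ^ (j div 4) * \<i> ^ (j mod 4)"
    by (metis mult_div_mod_eq power_add power_mult)
  then have "\<i> ^ j = \<i> ^ (j mod 4)" by simp
  moreover have "j mod 4 \<in> {1, 2, 3}" using j by (auto simp: dvd_eq_mod_eq_0)
  ultimately show ?thesis by (auto simp: power3_eq_cube complex_eq_iff)
qed

text \<open>\<open>omega 3\<close> is a primitive sixth root of unity: its cube is
  \<open>- 1\<close>, which reduces the exponent modulo \<open>6\<close> and leaves five powers to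
  inspect.\<close>

lemma omega3_power_neq_1:
  assumes "\<not> 6 dvd j"
  shows "omega 3 ^ j \<noteq> 1"
proof -
  have 2: "omega 3 ^ 2 = omega 3 - 1"
    by (simp add: power2_eq_square omega_3_square)
  note 3 = omega_3_cube
  have "omega 3 ^ j = ((omega 3 ^ 3) ^ 2) ^ (j div 6) * omega 3 ^ (j mod 6)"
    by (simp flip: power_mult power_add)
  then have j: "omega 3 ^ j = omega 3 ^ (j mod 6)" by (simp add: 3)
  have "omega 3 ^ 4 = omega 3 ^ 3 * omega 3" "omega 3 ^ 5 = omega 3 ^ 3 * omega 3 ^ 2"
    by (simp_all flip: power_Suc2 power_add)
  then have "omega 3 ^ 4 = - omega 3" "omega 3 ^ 5 = 1 - omega 3"
    unfolding 2 3 by simp_all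
  moreover have "Im (omega 3) > 0" by (simp add: omega_def)
  then have "omega 3 \<noteq> 1" "omega 3 - 1 \<noteq> 1" "- omega 3 \<noteq> 1" "1 - omega 3 \<noteq> 1"
    by (auto simp: complex_eq_iff)
  moreover have "j mod 6 \<in> {1, 2, 3, 4, 5}" using assms by (auto simp: dvd_eq_mod_eq_0)
  ultimately show ?thesis unfolding j by (auto simp: 2 3)
qed

theorem theorem1p2:
  fixes D r :: nat
  assumes "D \<in> {1, 2, 3, 7, 11, 19, 43, 67, 163}"
    and "0 < r"
    and "norm_shell D (real r) \<noteq> {}"
  shows "ellipsoidal_design D (real r) (T_set D) (norm_shell D (real r)) \<and>
         has_strength D (real r) (T_set D) (norm_shell D (real r))"
proof (cases "D \<in> {1, 2}")
  case True
  then have D: "D mod 4 \<noteq> 3" "0 < D" by auto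
  interpret imag_quad "omega D" 0 "int D" using omega_12[OF D] .
  have class_one: "imag_quad_class_one (omega D) 0 (int D)"
  proof unfold_locales
    fix a :: int
    assume "0 < a" "3 * a\<^sup>2 \<le> 4 * int D - 0\<^sup>2"
    show "a = 1"
    \<comment> \<open>\<open>a \<ge> 2\<close> would give \<open>12 \<le> 4 * D\<close>, but
      \<open>D \<le> 2\<close>.\<close>
    proof (rule ccontr)
      assume "a \<noteq> 1"
      then have "2\<^sup>2 \<le> a\<^sup>2" using \<open>0 < a\<close> by (intro power_mono) auto
      then show False using \<open>3 * a\<^sup>2 \<le> 4 * int D - 0\<^sup>2\<close> True by auto
    qed
  qed
  show ?thesis
  proof (cases "D = 1")
    case 1: True
    show ?thesis
    proof (rule shell_design_strength[OF class_one ellipse_12[OF D(1)] _ _ assms(2,3)])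
      show "u ^ 4 = 1" if "u \<in> shell 1" for u
        using units_gauss that imag_quad_axioms by (simp add: 1)
      show "\<exists>u\<in>shell 1. u ^ j \<noteq> 1" if "\<not> 4 dvd j" for j
        \<comment> \<open>The witness is \<open>omega 1 = \<i>\<close>, with coordinates
          \<open>(0, 1)\<close> and norm \<open>1\<close>.\<close>
        using i_power_neq_1[OF that] in_shell_iff[of 0 1 1]
        by (intro bexI[of _ "omega D"]) (simp_all add: 1 omega_def)
    qed (simp add: T_set_def 1)
  next
    case False
    show ?thesis
    proof (rule shell_design_strength[OF class_one ellipse_12[OF D(1)] _ _ assms(2,3)])
      show "u ^ 2 = 1" if "u \<in> shell 1" for u
        using shell_1_trivial[OF _ that] True False by auto
      show "\<exists>u\<in>shell 1. u ^ j \<noteq> 1" if "\<not> 2 dvd j" for j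
        using that minus_1_shell by (intro bexI[of _ "- 1"]) auto
    qed (use True False in \<open>simp add: T_set_def\<close>)
  qed
next
  case False
  then have D: "D mod 4 = 3" "0 < D" using assms(1) by auto
  let ?q = "int ((1 + D) div 4)"
  interpret imag_quad "omega D" 1 ?q using omega_3[OF D] .
  have "?q \<in> {1, 2, 3, 5, 11, 17, 41}" using False assms(1) by auto
  then have class_one: "imag_quad_class_one (omega D) 1 ?q"
    using reduced_class_one[of ?q] by unfold_locales simp
  show ?thesis
  proof (cases "D = 3")
    case 3: True
    show ?thesis
    proof (rule shell_design_strength[OF class_one ellipse_3[OF D(1)] _ _ assms(2,3)])
      show "u ^ 6 = 1" if "u \<in> shell 1" for u
        using units_eisenstein that imag_quad_axioms by (simp add: 3)
      show "\<exists>u\<in>shell 1. u ^ j \<noteq> 1" if "\<not> 6 dvd j" for j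
        using omega3_power_neq_1[OF that] in_shell_iff[of 0 1 1]
        by (intro bexI[of _ "omega D"]) (simp_all add: 3)
    qed (simp add: T_set_def 3)
  next
    case not_3: False
    show ?thesis
    proof (rule shell_design_strength[OF class_one ellipse_3[OF D(1)] _ _ assms(2,3)])
      \<comment> \<open>Here \<open>4 * q - t\<^sup>2\<close> equals \<open>D\<close>, which is at
        least \<open>7\<close>.\<close>
      show "u ^ 2 = 1" if "u \<in> shell 1" for u
        using shell_1_trivial[OF _ that] assms(1) False not_3 by auto
      show "\<exists>u\<in>shell 1. u ^ j \<noteq> 1" if "\<not> 2 dvd j" for j
        using that minus_1_shell by (intro bexI[of _ "- 1"]) auto
    qed (use False not_3 in \<open>simp add: T_set_def\<close>)
  qed
qed

end
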